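(* A complete list of discrete point symmetry transformations of the equation $u_t+xu_y=u_{xx}$ that are independent up to combining with each other and with continuous point symmetry transformations of this equation is exhausted by the single involution $\mathscr I'$ alternating the sign of $u$, $$\mathscr I'\colon(t,x,y,u)\mapsto(t,x,y,-u).$$ Thus, the quotient group of the complete point symmetry pseudogroup $G$ of this equation with respect to its identity component is isomorphic to $\mathbb Z_2$.
   Context: The complete point symmetry pseudogroup $G$ of the equation $u_t+xu_y=u_{xx}$ (for real $u=u(t,x,y)$) is the set of all point transformations (local diffeomorphisms of $\mathbb R^4_{t,x,y,u}$) mapping the equation to itself. Its elements are the transformations $\Phi_{\alpha,\beta,\gamma,\delta,\lambda_0,\lambda_1,\lambda_2,\lambda_3,\sigma,f}\colon(t,x,y,u)\mapsto(\tilde t,\tilde x,\tilde y,\tilde u)$ given by $$\tilde t=\frac{\alpha t+\beta}{\gamma t+\delta},\quad \tilde x=\frac{\hat x}{\gamma t+\delta}-\frac{3\gamma\hat y}{(\gamma t+\delta)^2},\quad \tilde y=\frac{\hat y}{(\gamma t+\delta)^3},$$ $$\tilde u=\sigma(\gamma t+\delta)^2\exp\left(\frac{\gamma\hat x^2}{\gamma t+\delta}-\frac{3\gamma^2\hat x\hat y}{(\gamma t+\delta)^2}+\frac{3\gamma^3\hat y^2}{(\gamma t+\delta)^3}\right)\exp\bigl(3\lambda_3(y-tx)-\lambda_2x-(3\lambda_3^2t^3+3\lambda_3\lambda_2t^2+\lambda_2^2t)\bigr)\bigl(u+f(t,x,y)\bigr),$$ where $\hat x:=x+3\lambda_3t^2+2\lambda_2t+\lambda_1$,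 $\hat y:=y+\lambda_3t^3+\lambda_2t^2+\lambda_1t+\lambda_0$; $\alpha,\beta,\gamma,\delta$ are real constants with $\alpha\delta-\beta\gamma=1$; $\lambda_0,\dots,\lambda_3,\sigma$ are real constants with $\sigma\ne0$; and $f$ is a solution of the equation. Each such transformation is taken with its natural domain $(\operatorname{dom}f\times\mathbb R_u)\setminus\{(t,x,y,u):\gamma t+\delta=0\}$. The group operation in $G$ is the modified composition: the ordinary composition of two transformations of the form $\Phi_{\alpha,\beta,\gamma,\delta,\lambda_0,\lambda_1,\lambda_2,\lambda_3,\sigma,f}$ (which is again of the form $\Phi_{\tilde\alpha,\tilde\beta,\tilde\gamma,\tilde\delta,\tilde\lambda_0,\tilde\lambda_1,\tilde\lambda_2,\tilde\lambda_3,\tilde\sigma,\tilde f}$), extended by continuity to $(\operatorname{dom}\tilde f\times\mathbb R_u)\setminus\{\tilde\gamma t+\tilde\delta=0\}$, where $\tilde\gamma,\tilde\delta,\tilde f$ are the parameters of the composition and $\operatorname{dom}\tilde f$ is the set of points of $\operatorname{dom}f^2$ (with $f^2$ the parameter function of the inner transformation) that are mapped into $\operatorname{dom}f^1$ (with $f^1$ the parameter function of the outer one) by the $(t,x,y)$-part of the inner transformation. Continuous point symmetry transformations are those in the identity component of $G$ (transformations that can be continuously connected with the identity within $G$); discrete ones are those outside it. *)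

theory Defs
  imports "HOL-Analysis.Analysis" "HOL-Algebra.Elementary_Groups"
begin

section \<open>Solutions of the equation \<open>u\<^sub>t + x u\<^sub>y = u\<^sub>x\<^sub>x\<close>\<close>

type_synonym base_point = "real \<times> real \<times> real" \<comment> \<open>\<open>(t, x, y)\<close>\<close>
type_synonym point = "real \<times> real \<times> real \<times> real" \<comment> \<open>\<open>(t, x, y, u)\<close>\<close>

text \<open>Partially defined maps are rendered as \<open>'a \<rightharpoonup> 'b\<close>, so that the domain is part of the map;
  the identity transformation is then the constructor \<^const>\<open>Some\<close>.\<close>

fun Ck_on :: "nat \<Rightarrow> ('a::real_normed_vector \<Rightarrow> 'b::real_normed_vector) \<Rightarrow> 'a set \<Rightarrow> bool" where
  "Ck_on 0 g D \<longleftrightarrow> continuous_on D g"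
| "Ck_on (Suc k) g D \<longleftrightarrow> (\<forall>z\<in>D. g differentiable (at z)) \<and>
     (\<forall>v. Ck_on k (\<lambda>z. frechet_derivative g (at z) v) D)"

definition smooth_on :: "('a::real_normed_vector \<Rightarrow> 'b::real_normed_vector) \<Rightarrow> 'a set \<Rightarrow> bool" where
  "smooth_on g D \<longleftrightarrow> (\<forall>k. Ck_on k g D)"

definition D_t :: "(base_point \<Rightarrow> real) \<Rightarrow> base_point \<Rightarrow> real" where
  "D_t g z = frechet_derivative g (at z) (1, 0, 0)"

definition D_x :: "(base_point \<Rightarrow> real) \<Rightarrow> base_point \<Rightarrow> real" where
  "D_x g z = frechet_derivative g (at z) (0, 1, 0)"

definition D_y :: "(base_point \<Rightarrow> real) \<Rightarrow> base_point \<Rightarrow> real" where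
  "D_y g z = frechet_derivative g (at z) (0, 0, 1)"

text \<open>A solution is smooth on a nonempty open set, which need not be connected.\<close>

definition is_solution :: "(base_point \<rightharpoonup> real) \<Rightarrow> bool" where
  "is_solution f \<longleftrightarrow> open (dom f) \<and> dom f \<noteq> {} \<and> smooth_on (\<lambda>z. the (f z)) (dom f) \<and>
     (\<forall>(t, x, y)\<in>dom f.
        D_t (\<lambda>z. the (f z)) (t, x, y) + x * D_y (\<lambda>z. the (f z)) (t, x, y)
          = D_x (D_x (\<lambda>z. the (f z))) (t, x, y))"

section \<open>The point symmetry pseudogroup\<close>

record params =
  alpha :: real
  beta :: real
  gamma :: real
  delta :: real
  lambda0 :: real
  lambda1 :: real
  lambda2 :: real
  lambda3 :: real
  sigma :: real
  sol :: "base_point \<rightharpoonup> real"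

definition valid_params :: "params \<Rightarrow> bool" where
  "valid_params p \<longleftrightarrow> alpha p * delta p - beta p * gamma p = 1 \<and> sigma p \<noteq> 0 \<and> is_solution (sol p)"

definition den :: "params \<Rightarrow> real \<Rightarrow> real" where
  "den p t = gamma p * t + delta p"

definition x_hat :: "params \<Rightarrow> base_point \<Rightarrow> real" where
  "x_hat p = (\<lambda>(t, x, y). x + 3 * lambda3 p * t^2 + 2 * lambda2 p * t + lambda1 p)"

definition y_hat :: "params \<Rightarrow> base_point \<Rightarrow> real" where
  "y_hat p = (\<lambda>(t, x, y). y + lambda3 p * t^3 + lambda2 p * t^2 + lambda1 p * t + lambda0 p)"

text \<open>The \<open>(t, x, y)\<close>-part of a transformation; meaningful only where \<^term>\<open>den p t \<noteq> 0\<close>.\<close>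

definition base_part :: "params \<Rightarrow> base_point \<Rightarrow> base_point" where
  "base_part p = (\<lambda>(t, x, y).
     ((alpha p * t + beta p) / den p t,
      x_hat p (t, x, y) / den p t - 3 * gamma p * y_hat p (t, x, y) / (den p t)^2,
      y_hat p (t, x, y) / (den p t)^3))"

definition multiplier :: "params \<Rightarrow> base_point \<Rightarrow> real" where
  "multiplier p = (\<lambda>(t, x, y).
     let xh = x_hat p (t, x, y); yh = y_hat p (t, x, y); d = den p t in
     sigma p * d^2
     * exp (gamma p * xh^2 / d - 3 * (gamma p)^2 * xh * yh / d^2 + 3 * (gamma p)^3 * yh^2 / d^3)
     * exp (3 * lambda3 p * (y - t * x) - lambda2 p * x
            - (3 * (lambda3 p)^2 * t^3 + 3 * lambda3 p * lambda2 p * t^2 + (lambda2 p)^2 * t)))"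

definition Phi :: "params \<Rightarrow> point \<rightharpoonup> point" where
  "Phi p = (\<lambda>(t, x, y, u).
     case sol p (t, x, y) of
       None \<Rightarrow> None
     | Some v \<Rightarrow>
         if den p t = 0 then None
         else (case base_part p (t, x, y) of (t', x', y') \<Rightarrow>
                 Some (t', x', y', multiplier p (t, x, y) * (u + v))))"

definition G :: "(point \<rightharpoonup> point) set" where
  "G = {Phi p | p. valid_params p}"

section \<open>Modified composition\<close>

text \<open>\<open>comp_extension \<Phi>1 \<Phi>2 \<Psi>\<close>: the element \<open>\<Psi>\<close> of \<^const>\<open>G\<close> extends the ordinary composition
  \<open>\<Phi>1 \<circ> \<Phi>2\<close>. Away from the hyperplane \<^term>\<open>den p2 t = 0\<close>, on which \<open>\<Phi>2\<close> is undefined, the domain of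
  its parameter function consists of exactly the points of \<^term>\<open>dom (sol p2)\<close> that the
  \<open>(t, x, y)\<close>-part of \<open>\<Phi>2\<close> maps into \<^term>\<open>dom (sol p1)\<close>; on this hyperplane it may contain further
  points of \<^term>\<open>dom (sol p2)\<close>. The values there are the continuous extensions, since the hyperplane
  is nowhere dense and \<open>\<Psi>\<close> is continuous.

  The modified composition is the largest such extension, hence it is unique whenever it exists.
  Existence requires the resulting domain to be nonempty, that is, it is a partial operation.
  For instance, a transformation with \<^term>\<open>sol p = (\<lambda>z. Some 0)\<close> and \<^term>\<open>gamma p \<noteq> 0\<close> composed with
  its inverse gives the identity on the whole space, not only off a hyperplane.\<close>

definition comp_extension :: "(point \<rightharpoonup> point) \<Rightarrow> (point \<rightharpoonup> point) \<Rightarrow> (point \<rightharpoonup> point) \<Rightarrow> bool" where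
  "comp_extension \<Phi>1 \<Phi>2 \<Psi> \<longleftrightarrow> (\<exists>p1 p2 q.
     valid_params p1 \<and> valid_params p2 \<and> valid_params q \<and>
     \<Phi>1 = Phi p1 \<and> \<Phi>2 = Phi p2 \<and> \<Psi> = Phi q \<and>
     dom (sol q) \<subseteq> dom (sol p2) \<and>
     (\<forall>t x y. den p2 t \<noteq> 0 \<longrightarrow>
        ((t, x, y) \<in> dom (sol q) \<longleftrightarrow>
           (t, x, y) \<in> dom (sol p2) \<and> base_part p2 (t, x, y) \<in> dom (sol p1))) \<and>
     (\<Phi>1 \<circ>\<^sub>m \<Phi>2) \<subseteq>\<^sub>m \<Psi>)"

definition modified_comp :: "(point \<rightharpoonup> point) \<Rightarrow> (point \<rightharpoonup> point) \<Rightarrow> (point \<rightharpoonup> point) \<Rightarrow> bool" where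
  "modified_comp \<Phi>1 \<Phi>2 \<Psi> \<longleftrightarrow>
     comp_extension \<Phi>1 \<Phi>2 \<Psi> \<and> (\<forall>\<Psi>'. comp_extension \<Phi>1 \<Phi>2 \<Psi>' \<longrightarrow> \<Psi>' \<subseteq>\<^sub>m \<Psi>)"

section \<open>Identity component, discrete symmetries\<close>

text \<open>Paths are taken with respect to the compact-open topology for partial maps with open domains:
  the total domain is relatively open and the evaluation on it is jointly continuous.\<close>

definition continuous_path_in_G :: "(real \<Rightarrow> (point \<rightharpoonup> point)) \<Rightarrow> bool" where
  "continuous_path_in_G F \<longleftrightarrow>
     (\<forall>s\<in>{0..1}. F s \<in> G) \<and>
     openin (top_of_set ({0..1} \<times> UNIV)) {(s, w). s \<in> {0..1} \<and> w \<in> dom (F s)} \<and>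
     continuous_on {(s, w). s \<in> {0..1} \<and> w \<in> dom (F s)} (\<lambda>(s, w). the (F s w))"

definition identity_component :: "(point \<rightharpoonup> point) set" where
  "identity_component = {\<Phi>. \<exists>F. continuous_path_in_G F \<and> F 0 = Some \<and> F 1 = \<Phi>}"

definition discrete_symmetries :: "(point \<rightharpoonup> point) set" where
  "discrete_symmetries = G - identity_component"

inductive_set generated_by :: "(point \<rightharpoonup> point) set \<Rightarrow> (point \<rightharpoonup> point) set"
  for S :: "(point \<rightharpoonup> point) set" where
  base: "\<Phi> \<in> S \<Longrightarrow> \<Phi> \<in> generated_by S"
| comp: "\<lbrakk>\<Phi>1 \<in> generated_by S; \<Phi>2 \<in> generated_by S; modified_comp \<Phi>1 \<Phi>2 \<Psi>\<rbrakk>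
    \<Longrightarrow> \<Psi> \<in> generated_by S"
| inverse: "\<lbrakk>\<Phi> \<in> generated_by S; \<Psi> \<in> G; dom \<Psi> = ran \<Phi>; \<Psi> \<circ>\<^sub>m \<Phi> = Some |` dom \<Phi>\<rbrakk>
    \<Longrightarrow> \<Psi> \<in> generated_by S"

definition complete_list_of_independent_discrete_symmetries :: "(point \<rightharpoonup> point) set \<Rightarrow> bool" where
  "complete_list_of_independent_discrete_symmetries L \<longleftrightarrow>
     L \<subseteq> discrete_symmetries \<and>
     discrete_symmetries \<subseteq> generated_by (identity_component \<union> L) \<and>
     (\<forall>I\<in>L. I \<notin> generated_by (identity_component \<union> (L - {I})))"

definition is_involution :: "(point \<rightharpoonup> point) \<Rightarrow> bool" where
  "is_involution I \<longleftrightarrow> I \<in> G \<and> I \<noteq> Some \<and> modified_comp I I Some"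

definition sign_change :: "point \<rightharpoonup> point" where
  "sign_change = (\<lambda>(t, x, y, u). Some (t, x, y, - u))"

section \<open>The quotient by the identity component\<close>

text \<open>Since composing may shrink domains, the cosets \<open>identity_component \<circ> \<Phi>\<close> need not be disjoint
  or equal. The quotient therefore consists of the classes of the equivalence relation generated by
  identifying all elements of each coset with its representative \<open>\<Phi>\<close>; for a group this is the
  usual partition into cosets. As in \<^const>\<open>FactGroup\<close>, classes are multiplied elementwise and the
  neutral element is the subgroup factored out.\<close>

definition coset_step :: "((point \<rightharpoonup> point) \<times> (point \<rightharpoonup> point)) set" where
  "coset_step = {(\<Phi>, \<Psi>). \<Phi> \<in> G \<and> \<Psi> \<in> G \<and> (\<exists>N\<in>identity_component. modified_comp N \<Phi> \<Psi>)}"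

definition coset_rel :: "((point \<rightharpoonup> point) \<times> (point \<rightharpoonup> point)) set" where
  "coset_rel = (coset_step \<union> coset_step\<inverse>)\<^sup>* \<inter> G \<times> G"

definition quotient_G :: "(point \<rightharpoonup> point) set monoid" where
  "quotient_G =
     \<lparr>carrier = G // coset_rel,
      monoid.mult = (\<lambda>A B. {\<Psi>. \<exists>\<Phi>1\<in>A. \<exists>\<Phi>2\<in>B. modified_comp \<Phi>1 \<Phi>2 \<Psi>}),
      one = identity_component\<rparr>"

end

theory Submission
  imports Defs
begin

text \<open>The \<open>u\<close>-derivative of a transformation is its multiplier, whose sign is that of \<open>\<sigma>\<close>. This sign is
  constant along paths in \<open>G\<close> and multiplicative under composition. Conversely, if \<open>\<sigma> > 0\<close>, an explicit
  path joins the transformation to the identity: move the \<open>SL(2, \<real>)\<close> part along an Iwasawa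
  decomposition, scale the \<open>\<lambda>\<^sub>i\<close> and \<open>ln \<sigma>\<close> linearly, and switch \<open>f\<close> on by a scalar factor. So the identity
  component is \<open>\<sigma> > 0\<close>. The only compositions that have to be computed are those with a scaling of \<open>u\<close>
  as inner transformation, which merely changes \<open>\<sigma>\<close> and multiplies \<open>f\<close> by a constant.\<close>

section \<open>Rescaling solutions\<close>

definition scaled_sol :: "real \<Rightarrow> (base_point \<rightharpoonup> real) \<Rightarrow> (base_point \<rightharpoonup> real)" where
  "scaled_sol c f = (\<lambda>z. map_option ((*) c) (f z))"

lemma dom_scaled_sol [simp]: "dom (scaled_sol c f) = dom f"
  by (auto simp: scaled_sol_def dom_def)

lemma the_scaled_sol: "z \<in> dom f \<Longrightarrow> the (scaled_sol c f z) = c * the (f z)"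
  by (auto simp: scaled_sol_def)

lemma scaled_sol_1 [simp]: "scaled_sol 1 f = f"
proof
  show "scaled_sol 1 f z = f z" for z
    by (cases "f z") (simp_all add: scaled_sol_def)
qed

lemma scaled_sol_scaled_sol [simp]: "scaled_sol c (scaled_sol d f) = scaled_sol (c * d) f"
proof
  show "scaled_sol c (scaled_sol d f) z = scaled_sol (c * d) f z" for z
    by (cases "f z") (simp_all add: scaled_sol_def)
qed

text \<open>In the applications the functions are of the form \<open>the (f z)\<close>, unspecified
  off \<open>dom f\<close>, so proportionality is known only on \<open>D\<close>; openness of
  \<open>D\<close> makes this enough for the derivative at \<open>z\<close>.\<close>

lemma has_derivative_scale_on_open:
  fixes g h :: "'a::real_normed_vector \<Rightarrow> real"
  assumes "open D" "z \<in> D" "\<And>w. w \<in> D \<Longrightarrow> h w = c * g w" "g differentiable (at z)"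
  shows "(h has_derivative (\<lambda>v. c * frechet_derivative g (at z) v)) (at z)"
proof -
  have "((\<lambda>w. c * g w) has_derivative (\<lambda>v. c * frechet_derivative g (at z) v)) (at z)"
    using assms(4) by (intro has_derivative_mult_right) (simp add: frechet_derivative_works)
  then show ?thesis
    by (rule has_derivative_transform_within_open [OF _ assms(1,2)]) (simp add: assms(3))
qed

lemma frechet_derivative_scale_on_open:
  fixes g h :: "'a::real_normed_vector \<Rightarrow> real"
  assumes "open D" "z \<in> D" "\<And>w. w \<in> D \<Longrightarrow> h w = c * g w" "g differentiable (at z)"
  shows "frechet_derivative h (at z) = (\<lambda>v. c * frechet_derivative g (at z) v)"
  using frechet_derivative_at [OF has_derivative_scale_on_open [OF assms]] by simp

text \<open>The induction generalises over \<open>g\<close> and \<open>h\<close> because its step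
  concerns their directional derivatives, which are again proportional on \<open>D\<close>.\<close>

lemma Ck_on_scale:
  fixes g h :: "'a::real_normed_vector \<Rightarrow> real"
  assumes "open D" "\<And>w. w \<in> D \<Longrightarrow> h w = c * g w" "Ck_on k g D"
  shows "Ck_on k h D"
  using assms(2,3)
proof (induction k arbitrary: g h)
  case 0
  have "continuous_on D (\<lambda>w. c * g w)"
    using 0 by (auto intro: continuous_intros)
  then show ?case
    using 0 by (simp cong: continuous_on_cong)
next
  case (Suc k)
  have g: "g differentiable (at z)" if "z \<in> D" for z
    using Suc.prems that by simp
  have "h differentiable (at z)" if "z \<in> D" for z
    using has_derivative_scale_on_open [OF assms(1) that Suc.prems(1) g [OF that]]
    unfolding differentiable_def by blast
  moreover have "Ck_on k (\<lambda>z. frechet_derivative h (at z) v) D" for v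
  proof (rule Suc.IH)
    show "frechet_derivative h (at z) v = c * frechet_derivative g (at z) v" if "z \<in> D" for z
      using frechet_derivative_scale_on_open [OF assms(1) that Suc.prems(1) g [OF that]] by simp
    show "Ck_on k (\<lambda>z. frechet_derivative g (at z) v) D"
      using Suc.prems by simp
  qed
  ultimately show ?case by simp
qed

text \<open>The equation is linear and homogeneous, so a constant factor passes through every
  term.\<close>

lemma is_solution_scaled_sol:
  assumes "is_solution f"
  shows "is_solution (scaled_sol c f)"
proof -
  let ?D = "dom f"
  let ?g = "\<lambda>z. the (f z)" and ?h = "\<lambda>z. the (scaled_sol c f z)"
  have D: "open ?D" "?D \<noteq> {}" and sm: "\<And>k. Ck_on k ?g ?D"
    and pde: "\<And>t x y. (t, x, y) \<in> ?D \<Longrightarrow>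
      D_t ?g (t, x, y) + x * D_y ?g (t, x, y) = D_x (D_x ?g) (t, x, y)"
    using assms unfolding is_solution_def smooth_on_def by blast+
  have h: "?h z = c * ?g z" if "z \<in> ?D" for z
    using that by (rule the_scaled_sol)
  have fd: "frechet_derivative ?h (at z) v = c * frechet_derivative ?g (at z) v" if "z \<in> ?D" for z v
    using frechet_derivative_scale_on_open [OF D(1) that h] sm [of 1] that by simp
  then have "D_t ?h z = c * D_t ?g z" "D_x ?h z = c * D_x ?g z" "D_y ?h z = c * D_y ?g z"
    if "z \<in> ?D" for z
    using that by (simp_all add: D_t_def D_x_def D_y_def)
  moreover have "D_x (D_x ?h) z = c * D_x (D_x ?g) z" if "z \<in> ?D" for z
  proof -
    \<comment> \<open>Scaling the second derivative requires the first one to be differentiable;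
      \<open>Ck_on\<close> at order 2 gives this for the derivative in direction
      \<open>(0, 1, 0)\<close>, which is \<open>D_x\<close>.\<close>
    have "D_x ?g differentiable (at z)"
    proof -
      have "Ck_on (Suc 0) (\<lambda>z. frechet_derivative ?g (at z) (0, 1, 0)) ?D"
        using sm [of "Suc (Suc 0)"] unfolding Ck_on.simps(2) [of "Suc 0"] by blast
      then show ?thesis
        using that by (simp add: D_x_def [abs_def])
    qed
    then show ?thesis
      using frechet_derivative_scale_on_open [OF D(1) that, of "D_x ?h" c "D_x ?g"] calculation(2)
      by (simp add: D_x_def [of "D_x _"])
  qed
  ultimately have "D_t ?h (t, x, y) + x * D_y ?h (t, x, y) = D_x (D_x ?h) (t, x, y)"
    if "(t, x, y) \<in> ?D" for t x y
    using pde [OF that, symmetric] that by (simp add: algebra_simps)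
  moreover have "smooth_on ?h ?D"
    unfolding smooth_on_def using Ck_on_scale [OF D(1) h sm] by blast
  ultimately show ?thesis
    using D unfolding is_solution_def by auto
qed

lemma is_solution_zero: "is_solution (\<lambda>z. Some 0)"
proof -
  have "Ck_on k (\<lambda>z. 0) (UNIV :: base_point set)" for k
    by (induction k) auto
  moreover have "(UNIV :: base_point set) \<noteq> {}" by simp
  ultimately show ?thesis
    unfolding is_solution_def smooth_on_def
    by (auto simp: D_t_def D_x_def [abs_def] D_y_def dom_def)
qed

section \<open>Elements of the pseudogroup\<close>

lemma mem_dom_Phi:
  "(t, x, y, u) \<in> dom (Phi p) \<longleftrightarrow> (t, x, y) \<in> dom (sol p) \<and> den p t \<noteq> 0"
  by (auto simp: Phi_def split: option.splits prod.splits)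

lemma the_Phi:
  assumes "(t, x, y) \<in> dom (sol p)" "den p t \<noteq> 0"
  shows "Phi p (t, x, y, u) = Some (fst (base_part p (t, x, y)), fst (snd (base_part p (t, x, y))),
     snd (snd (base_part p (t, x, y))), multiplier p (t, x, y) * (u + the (sol p (t, x, y))))"
  using assms by (auto simp: Phi_def split: option.splits prod.splits)

text \<open>Besides \<open>sigma p\<close>, the factors are the square of a nonzero denominator and
  two exponentials, all positive.\<close>

lemma sgn_multiplier: "den p t \<noteq> 0 \<Longrightarrow> sgn (multiplier p (t, x, y)) = sgn (sigma p)"
  by (simp add: multiplier_def Let_def sgn_mult power_sgn [symmetric] del: power_sgn)

lemma fst_base_part: "fst (base_part p (t, x, y)) = (alpha p * t + beta p) / den p t"
  by (simp add: base_part_def)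

text \<open>\<open>x_hat\<close> has slope 1 in \<open>x\<close>, and \<open>y_hat\<close> does not
  involve \<open>x\<close>. This finite difference stands in for the partial derivative.\<close>

lemma base_part_diff_x:
  "fst (snd (base_part p (t, x + h, y))) - fst (snd (base_part p (t, x, y))) = h / den p t"
  by (simp add: base_part_def x_hat_def y_hat_def add_divide_distrib diff_divide_distrib)

section \<open>Open sets of base points and finite sets of exceptional \<open>t\<close>\<close>

lemma open_box_triple:
  fixes D :: "base_point set"
  assumes "open D" "(t, x, y) \<in> D"
  obtains e where "e > 0"
    "\<And>t' x' y'. \<bar>t' - t\<bar> < e \<Longrightarrow> \<bar>x' - x\<bar> < e \<Longrightarrow> \<bar>y' - y\<bar> < e \<Longrightarrow> (t', x', y') \<in> D"
proof -
  obtain A B where AB: "open A" "open B" "t \<in> A" "(x, y) \<in> B" "A \<times> B \<subseteq> D"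
    using open_prod_elim [OF assms] by (metis SigmaD1 SigmaD2)
  obtain X Y where XY: "open X" "open Y" "x \<in> X" "y \<in> Y" "X \<times> Y \<subseteq> B"
    using open_prod_elim [OF AB(2,4)] by (metis SigmaD1 SigmaD2)
  obtain a b c where "a > 0" "b > 0" "c > 0" and
    abc: "\<And>s. \<bar>s - t\<bar> < a \<Longrightarrow> s \<in> A" "\<And>s. \<bar>s - x\<bar> < b \<Longrightarrow> s \<in> X" "\<And>s. \<bar>s - y\<bar> < c \<Longrightarrow> s \<in> Y"
    using AB XY by (metis open_dist dist_real_def)
  then show thesis
    using AB(5) XY(5) by (intro that [of "min a (min b c)"]) (simp_all add: subset_eq)
qed

lemma infinite_abs_diff_less:
  fixes t e :: real
  assumes "e > 0"
  shows "infinite {s. \<bar>s - t\<bar> < e}"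
proof -
  have "{s. \<bar>s - t\<bar> < e} = {t - e <..< t + e}" by auto
  then show ?thesis using assms by simp
qed

text \<open>Inside a box around a point of \<open>D\<close>, \<open>t\<close> runs through
  infinitely many values with \<open>x\<close> and \<open>y\<close> fixed, so one of them misses
  \<open>Z\<close>.\<close>

lemma open_triple_avoids_finite:
  fixes D :: "base_point set"
  assumes "open D" "D \<noteq> {}" "finite Z"
  obtains t x y where "(t, x, y) \<in> D" "t \<notin> Z"
proof -
  obtain t x y where "(t, x, y) \<in> D" using assms by auto
  then obtain e where e: "e > 0"
    "\<And>t' x' y'. \<bar>t' - t\<bar> < e \<Longrightarrow> \<bar>x' - x\<bar> < e \<Longrightarrow> \<bar>y' - y\<bar> < e \<Longrightarrow> (t', x', y') \<in> D"
    using open_box_triple [OF assms(1)] by metis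
  have "infinite ({s. \<bar>s - t\<bar> < e} - Z)"
    using infinite_abs_diff_less [OF e(1)] assms(3) by (rule Diff_infinite_finite [rotated])
  then obtain s where "s \<in> {s. \<bar>s - t\<bar> < e} - Z"
    using infinite_imp_nonempty by blast
  then show thesis using that [of s x y] e by auto
qed

lemma finite_zeros_linear:
  fixes a b :: real
  assumes "a \<noteq> 0 \<or> b \<noteq> 0"
  shows "finite {t. a * t + b = 0}"
proof (rule finite_subset)
  show "{t. a * t + b = 0} \<subseteq> {- b / a}"
    using assms by (cases "a = 0") (auto simp: field_simps eq_neg_iff_add_eq_0)
qed simp

lemma finite_zeros_den:
  assumes "valid_params p"
  shows "finite {t. den p t = 0}"
  unfolding den_def using assms by (intro finite_zeros_linear) (auto simp: valid_params_def)

lemma open_dom_sol: "valid_params p \<Longrightarrow> open (dom (sol p))"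
  and dom_sol_nonempty: "valid_params p \<Longrightarrow> dom (sol p) \<noteq> {}"
  by (auto simp: valid_params_def is_solution_def)

text \<open>The nonempty open domain of a solution cannot lie within the zero set of the
  denominator, so no element of \<open>G\<close> is the empty map.\<close>

lemma dom_Phi_nonempty:
  assumes "valid_params p"
  obtains t x y where "(t, x, y) \<in> dom (sol p)" "den p t \<noteq> 0"
  using open_triple_avoids_finite [OF open_dom_sol [OF assms] dom_sol_nonempty [OF assms]
      finite_zeros_den [OF assms]] that by (metis (mono_tags) mem_Collect_eq)

text \<open>The denominator is read off a transformation as \<open>1 / (\<partial>\<^sub>x x')\<close>.\<close>

lemma den_unique:
  assumes p: "valid_params p" and le: "Phi p \<subseteq>\<^sub>m Phi q"
  shows "den p = den q"
proof -
  obtain t x y where z: "(t, x, y) \<in> dom (sol p)"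
    using dom_sol_nonempty [OF p] by (metis equals0I prod_cases3)
  then obtain e where e: "e > 0"
    "\<And>t' x' y'. \<bar>t' - t\<bar> < e \<Longrightarrow> \<bar>x' - x\<bar> < e \<Longrightarrow> \<bar>y' - y\<bar> < e \<Longrightarrow> (t', x', y') \<in> dom (sol p)"
    using open_box_triple [OF open_dom_sol [OF p]] by metis
  have eq: "den p s = den q s" if s: "\<bar>s - t\<bar> < e" "den p s \<noteq> 0" for s
  proof -
    let ?h = "e / 2"
    have dp: "(s, x, y) \<in> dom (sol p)" "(s, x + ?h, y) \<in> dom (sol p)"
      using e s(1) by auto
    then have "(s, x, y, 0) \<in> dom (Phi p)" "(s, x + ?h, y, 0) \<in> dom (Phi p)"
      using s(2) by (simp_all add: mem_dom_Phi)
    then have *: "Phi p (s, x, y, 0) = Phi q (s, x, y, 0)"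
      "Phi p (s, x + ?h, y, 0) = Phi q (s, x + ?h, y, 0)"
      "(s, x, y, 0) \<in> dom (Phi q)" "(s, x + ?h, y, 0) \<in> dom (Phi q)"
      using le map_le_implies_dom_le [OF le] unfolding map_le_def by blast+
    then have q: "(s, x, y) \<in> dom (sol q)" "(s, x + ?h, y) \<in> dom (sol q)" "den q s \<noteq> 0"
      by (simp_all add: mem_dom_Phi)
    have "fst (snd (base_part p (s, x, y))) = fst (snd (base_part q (s, x, y)))"
      "fst (snd (base_part p (s, x + ?h, y))) = fst (snd (base_part q (s, x + ?h, y)))"
      using *(1,2) by (simp_all add: the_Phi dp q s(2))
    then have "?h / den p s = ?h / den q s"
      using base_part_diff_x [of p s x ?h y] base_part_diff_x [of q s x ?h y] by metis
    then show ?thesis using e(1) s(2) q(3) by (simp add: field_simps)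
  qed
  \<comment> \<open>Two affine functions of \<open>s\<close> that agree at infinitely many points
    have equal coefficients.\<close>
  have "{s. \<bar>s - t\<bar> < e} - {s. den p s = 0} \<subseteq> {s. (gamma p - gamma q) * s + (delta p - delta q) = 0}"
    using eq by (auto simp: den_def algebra_simps)
  moreover have "infinite ({s. \<bar>s - t\<bar> < e} - {s. den p s = 0})"
    using infinite_abs_diff_less [OF e(1)] finite_zeros_den [OF p] by simp
  ultimately have "infinite {s. (gamma p - gamma q) * s + (delta p - delta q) = 0}"
    using finite_subset by blast
  then have "gamma p = gamma q \<and> delta p = delta q"
    using finite_zeros_linear [of "gamma p - gamma q" "delta p - delta q"] by auto
  then show ?thesis by (simp add: den_def fun_eq_iff)
qed

section \<open>The sign of \<open>sigma\<close> under inclusion and composition\<close>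

lemma sgn_sigma_unique:
  assumes "valid_params p" "Phi p \<subseteq>\<^sub>m Phi q"
  shows "sgn (sigma p) = sgn (sigma q)"
proof -
  obtain t x y where z: "(t, x, y) \<in> dom (sol p)" "den p t \<noteq> 0"
    using dom_Phi_nonempty [OF assms(1)] .
  have "\<And>u. (t, x, y, u) \<in> dom (Phi p)"
    using z by (simp add: mem_dom_Phi)
  then have *: "\<And>u. Phi p (t, x, y, u) = Phi q (t, x, y, u)" "(t, x, y, 0) \<in> dom (Phi q)"
    using assms(2) map_le_implies_dom_le [OF assms(2)] unfolding map_le_def by blast+
  then have q: "(t, x, y) \<in> dom (sol q)" "den q t \<noteq> 0" by (simp_all add: mem_dom_Phi)
  \<comment> \<open>The images of \<open>u = 0\<close> and \<open>u = 1\<close> differ in the last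
    coordinate by the multiplier; the value of the parameter function cancels.\<close>
  have "multiplier p (t, x, y) = multiplier q (t, x, y)"
    using *(1) [of 0] *(1) [of 1] by (simp add: the_Phi z q algebra_simps)
  then show ?thesis using sgn_multiplier [of _ t x y] z q by metis
qed

text \<open>Along the fibre over one base point the maps are affine in \<open>u\<close>, so their
  slopes multiply. The pointwise form serves both for extensions of compositions and for
  inverses.\<close>

lemma sgn_sigma_comp_at:
  assumes q: "(t, x, y) \<in> dom (sol q)" "den q t \<noteq> 0"
    and eq: "\<And>u. (Phi p1 \<circ>\<^sub>m Phi p2) (t, x, y, u) = Phi q (t, x, y, u)"
  shows "sgn (sigma q) = sgn (sigma p1) * sgn (sigma p2)"
proof -
  have "(t, x, y, 0) \<in> dom (Phi p1 \<circ>\<^sub>m Phi p2)"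
    unfolding domIff eq by (simp add: the_Phi [OF q])
  then obtain t' x' y' u' where w: "Phi p2 (t, x, y, 0) = Some (t', x', y', u')"
    "(t', x', y', u') \<in> dom (Phi p1)"
    by (auto simp: dom_def map_comp_Some_iff)
  then have d: "(t, x, y) \<in> dom (sol p2)" "den p2 t \<noteq> 0" "(t', x', y') \<in> dom (sol p1)" "den p1 t' \<noteq> 0"
    using mem_dom_Phi by blast+
  have b: "base_part p2 (t, x, y) = (t', x', y')"
    using w(1) by (simp add: the_Phi d prod_eq_iff)
  have "multiplier q (t, x, y) = multiplier p1 (t', x', y') * multiplier p2 (t, x, y)"
    using eq [of 0] eq [of 1] by (simp add: map_comp_def the_Phi d q b algebra_simps)
  then show ?thesis
    using sgn_multiplier [of q t x y] sgn_multiplier [of p1 t' x' y'] sgn_multiplier [of p2 t x y] q d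
    by (simp add: sgn_mult)
qed

text \<open>The pointwise rule applies at any point of \<open>dom (sol q)\<close> whose
  \<open>t\<close> avoids the zeros of the denominators of \<open>p2\<close> and \<open>q\<close>
  and is not sent to a zero of that of \<open>p1\<close>.\<close>

lemma sgn_sigma_comp:
  assumes p1: "valid_params p1" and p2: "valid_params p2" and q: "valid_params q"
    and dom_q: "\<And>t x y. den p2 t \<noteq> 0 \<Longrightarrow> (t, x, y) \<in> dom (sol q) \<Longrightarrow>
      (t, x, y) \<in> dom (sol p2) \<and> base_part p2 (t, x, y) \<in> dom (sol p1)"
    and le: "(Phi p1 \<circ>\<^sub>m Phi p2) \<subseteq>\<^sub>m Phi q"
  shows "sgn (sigma q) = sgn (sigma p1) * sgn (sigma p2)"
proof -
  \<comment> \<open>\<open>?a\<close> and \<open>?b\<close> form the lower row of the product of the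
    matrices of \<open>p1\<close> and \<open>p2\<close>, so \<open>?a * t + ?b\<close> will be
    \<open>den p1 t' * den p2 t\<close>.\<close>
  let ?a = "gamma p1 * alpha p2 + delta p1 * gamma p2"
  let ?b = "gamma p1 * beta p2 + delta p1 * delta p2"
  \<comment> \<open>Multiplying this row by the inverse matrix of \<open>p2\<close> recovers the
    lower row of \<open>p1\<close>; as that is nonzero, so is the product row.\<close>
  have "?a * delta p2 - ?b * gamma p2 = gamma p1" "?b * alpha p2 - ?a * beta p2 = delta p1"
    using p2 unfolding valid_params_def by algebra+
  moreover have "gamma p1 \<noteq> 0 \<or> delta p1 \<noteq> 0"
    using p1 by (auto simp: valid_params_def)
  ultimately have "?a \<noteq> 0 \<or> ?b \<noteq> 0" by auto
  then have "finite {t. ?a * t + ?b = 0}" by (rule finite_zeros_linear)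
  then obtain t x y where z: "(t, x, y) \<in> dom (sol q)" "den p2 t \<noteq> 0" "?a * t + ?b \<noteq> 0" "den q t \<noteq> 0"
    using open_triple_avoids_finite [OF open_dom_sol [OF q] dom_sol_nonempty [OF q],
        of "{t. ?a * t + ?b = 0} \<union> {t. den p2 t = 0} \<union> {t. den q t = 0}"]
      finite_zeros_den [OF p2] finite_zeros_den [OF q]
    by (metis (mono_tags, lifting) Un_iff finite_Un mem_Collect_eq)
  obtain t' x' y' where b: "base_part p2 (t, x, y) = (t', x', y')" by (metis prod_cases3)
  have "t' * den p2 t = alpha p2 * t + beta p2"
    using b fst_base_part [of p2 t x y] z(2) by simp
  then have "den p1 t' * den p2 t = ?a * t + ?b"
    unfolding den_def by algebra
  with z have d1: "den p1 t' \<noteq> 0" by auto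
  have d: "(t, x, y) \<in> dom (sol p2)" "(t', x', y') \<in> dom (sol p1)"
    using dom_q [OF z(2) z(1)] b by auto
  have "(Phi p1 \<circ>\<^sub>m Phi p2) (t, x, y, u) \<noteq> None" for u
    by (simp add: map_comp_def the_Phi d z b d1)
  then have "(Phi p1 \<circ>\<^sub>m Phi p2) (t, x, y, u) = Phi q (t, x, y, u)" for u
    using le by (auto simp: map_le_def dom_def)
  with z(1,4) show ?thesis by (rule sgn_sigma_comp_at)
qed

section \<open>Composition with scalings of the dependent variable\<close>

definition u_scaling :: "real \<Rightarrow> point \<rightharpoonup> point" where
  "u_scaling c = (\<lambda>(t, x, y, u). Some (t, x, y, c * u))"

definition scaling_params :: "real \<Rightarrow> params" where
  "scaling_params c = \<lparr>alpha = 1, beta = 0, gamma = 0, delta = 1, lambda0 = 0, lambda1 = 0,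
     lambda2 = 0, lambda3 = 0, sigma = c, sol = (\<lambda>z. Some 0)\<rparr>"

text \<open>Encodes the identity \<open>sigma * (c * u + f) = (c * sigma) * (u + f / c)\<close> for
  nonzero \<open>c\<close>.\<close>

definition rescaled :: "real \<Rightarrow> params \<Rightarrow> params" where
  "rescaled c p = p\<lparr>sigma := c * sigma p, sol := scaled_sol (1 / c) (sol p)\<rparr>"

lemma u_scaling_1: "u_scaling 1 = Some"
  by (auto simp: u_scaling_def)

lemma u_scaling_minus_1: "u_scaling (- 1) = sign_change"
  by (auto simp: u_scaling_def sign_change_def)

lemma valid_scaling_params: "c \<noteq> 0 \<Longrightarrow> valid_params (scaling_params c)"
  by (simp add: valid_params_def scaling_params_def is_solution_zero)

lemma den_scaling_params [simp]: "den (scaling_params c) t = 1"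
  by (simp add: den_def scaling_params_def)

lemma base_part_scaling_params [simp]: "base_part (scaling_params c) z = z"
  by (cases z) (simp add: base_part_def x_hat_def y_hat_def den_def scaling_params_def)

lemma sol_scaling_params [simp]: "sol (scaling_params c) z = Some 0"
  by (simp add: scaling_params_def)

lemma dom_sol_scaling_params [simp]: "dom (sol (scaling_params c)) = UNIV"
  by auto

lemma sigma_scaling_params [simp]: "sigma (scaling_params c) = c"
  by (simp add: scaling_params_def)

lemma Phi_scaling_params: "Phi (scaling_params c) = u_scaling c"
proof -
  have "multiplier (scaling_params c) z = c" for z
    by (cases z) (simp add: multiplier_def den_def scaling_params_def)
  then show ?thesis
    by (auto simp: Phi_def u_scaling_def fun_eq_iff)
qed

lemma valid_rescaled: "valid_params p \<Longrightarrow> c \<noteq> 0 \<Longrightarrow> valid_params (rescaled c p)"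
  by (simp add: valid_params_def rescaled_def is_solution_scaled_sol)

lemma den_rescaled [simp]: "den (rescaled c p) = den p"
  by (simp add: fun_eq_iff den_def rescaled_def)

lemma sigma_rescaled [simp]: "sigma (rescaled c p) = c * sigma p"
  by (simp add: rescaled_def)

lemma dom_sol_rescaled [simp]: "dom (sol (rescaled c p)) = dom (sol p)"
  by (simp add: rescaled_def)

text \<open>The inner map is defined everywhere and fixes the base point, so the ordinary
  composition already has the required form and nothing is left to extend by continuity.\<close>

lemma comp_u_scaling:
  assumes "c \<noteq> 0"
  shows "Phi p \<circ>\<^sub>m u_scaling c = Phi (rescaled c p)"
proof
  fix w :: point
  obtain t x y u where w: "w = (t, x, y, u)" by (metis prod_cases4)
  have b: "base_part (rescaled c p) = base_part p"
    by (simp add: fun_eq_iff base_part_def x_hat_def y_hat_def den_def rescaled_def)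
  have m: "multiplier (rescaled c p) (t, x, y) = c * multiplier p (t, x, y)"
    by (simp add: multiplier_def Let_def x_hat_def y_hat_def den_def rescaled_def)
  show "(Phi p \<circ>\<^sub>m u_scaling c) w = Phi (rescaled c p) w"
    using assms
    by (cases "sol p (t, x, y)")
      (auto simp: w map_comp_def u_scaling_def Phi_def b m rescaled_def [of c p, THEN arg_cong [of _ _ sol]]
         scaled_sol_def algebra_simps split: prod.splits)
qed

text \<open>Existence is \<open>comp_u_scaling\<close>. For maximality, a competing extension may
  present the same maps by other parameters \<open>p1\<close>, \<open>p2\<close>, \<open>q\<close>;
  comparing domains of parameter functions and denominators shows that it has no larger
  domain.\<close>

lemma modified_comp_u_scaling:
  assumes p: "valid_params p" and c: "c \<noteq> 0"
  shows "modified_comp (Phi p) (u_scaling c) (Phi (rescaled c p))"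
  unfolding modified_comp_def
proof (intro conjI allI impI)
  show "comp_extension (Phi p) (u_scaling c) (Phi (rescaled c p))"
    unfolding comp_extension_def
    by (rule exI [of _ p], rule exI [of _ "scaling_params c"], rule exI [of _ "rescaled c p"])
      (simp add: p c valid_scaling_params valid_rescaled Phi_scaling_params comp_u_scaling)
next
  fix \<Psi>
  assume "comp_extension (Phi p) (u_scaling c) \<Psi>"
  then obtain p1 p2 q where p1: "valid_params p1" and
    eq: "Phi p = Phi p1" "u_scaling c = Phi p2" "\<Psi> = Phi q" and
    dom_q: "\<And>t x y. den p2 t \<noteq> 0 \<Longrightarrow> (t, x, y) \<in> dom (sol q) \<longleftrightarrow>
           (t, x, y) \<in> dom (sol p2) \<and> base_part p2 (t, x, y) \<in> dom (sol p1)" and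
    le: "(Phi p \<circ>\<^sub>m u_scaling c) \<subseteq>\<^sub>m \<Psi>"
    unfolding comp_extension_def by blast
  \<comment> \<open>The parameters \<open>p2\<close> are known only through the map they present; as
    it is total and fixes base points, its denominator never vanishes and the domain condition holds
    at every point.\<close>
  have p2: "(t, x, y) \<in> dom (sol p2) \<and> den p2 t \<noteq> 0 \<and> base_part p2 (t, x, y) = (t, x, y)" for t x y
  proof -
    have *: "Phi p2 (t, x, y, 0) = Some (t, x, y, 0)"
      by (simp add: eq(2) [symmetric] u_scaling_def)
    then have d: "(t, x, y) \<in> dom (sol p2)" "den p2 t \<noteq> 0"
      using mem_dom_Phi by blast+
    with * show ?thesis
      by (simp add: the_Phi prod_eq_iff)
  qed
  have dom_eq: "dom (sol q) = dom (sol p1)"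
  proof (rule Set.set_eqI)
    show "z \<in> dom (sol q) \<longleftrightarrow> z \<in> dom (sol p1)" for z
      using dom_q p2 by (cases z rule: prod_cases3) (metis domIff)
  qed
  have le': "Phi (rescaled c p1) \<subseteq>\<^sub>m Phi q"
    using le comp_u_scaling [OF c, of p1] eq by simp
  \<comment> \<open>Equal denominators mean equal singular hyperplanes, so \<open>Phi q\<close>
    cannot gain points there.\<close>
  have den_eq: "den p1 = den q"
    using den_unique [OF valid_rescaled [OF p1 c] le'] by simp
  have "dom (Phi q) \<subseteq> dom (Phi (rescaled c p1))"
  proof
    show "w \<in> dom (Phi (rescaled c p1))" if "w \<in> dom (Phi q)" for w
      using that dom_eq den_eq
      by (cases w rule: prod_cases4) (simp only: mem_dom_Phi dom_sol_rescaled den_rescaled simp_thms)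
  qed
  \<comment> \<open>Both sides are \<open>Phi p\<close> after \<open>u_scaling c\<close>, which
    leads from \<open>p1\<close> back to \<open>p\<close>.\<close>
  moreover have "Phi (rescaled c p1) = Phi (rescaled c p)"
    using comp_u_scaling [OF c] eq(1) by metis
  ultimately have "dom \<Psi> \<subseteq> dom (Phi (rescaled c p))" "Phi (rescaled c p) \<subseteq>\<^sub>m \<Psi>"
    using le' eq(3) by (simp_all only:)
  then show "\<Psi> \<subseteq>\<^sub>m Phi (rescaled c p)"
    by (simp only: map_le_def subset_iff) metis
qed

section \<open>The identity component\<close>

text \<open>Iwasawa decomposition: the path is upper unitriangular times diagonal times rotation.\<close>

lemma SL2_path:
  fixes \<alpha> \<beta> \<gamma> \<delta> :: real
  assumes det: "\<alpha> * \<delta> - \<beta> * \<gamma> = 1"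
  obtains A B C D :: "real \<Rightarrow> real" where
    "continuous_on UNIV A" "continuous_on UNIV B" "continuous_on UNIV C" "continuous_on UNIV D"
    "\<forall>s. A s * D s - B s * C s = 1"
    "A 0 = 1" "B 0 = 0" "C 0 = 0" "D 0 = 1" "A 1 = \<alpha>" "B 1 = \<beta>" "C 1 = \<gamma>" "D 1 = \<delta>"
proof -
  define r where "r = sqrt (\<gamma>\<^sup>2 + \<delta>\<^sup>2)"
  have "\<gamma> \<noteq> 0 \<or> \<delta> \<noteq> 0" using det by auto
  then have pos: "\<gamma>\<^sup>2 + \<delta>\<^sup>2 > 0" by (simp add: sum_power2_gt_zero_iff)
  then have r: "r > 0" "r\<^sup>2 = \<gamma>\<^sup>2 + \<delta>\<^sup>2" by (simp_all add: r_def)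
  have "(\<delta> / r)\<^sup>2 + (\<gamma> / r)\<^sup>2 = (\<gamma>\<^sup>2 + \<delta>\<^sup>2) / r\<^sup>2"
    by (simp add: power_divide add_divide_distrib)
  also have "\<dots> = 1"
    using r by (metis less_irrefl power_eq_0_iff div_self)
  finally have "(\<delta> / r)\<^sup>2 + (\<gamma> / r)\<^sup>2 = 1" .
  then obtain \<theta> where "\<delta> / r = cos \<theta>" "\<gamma> / r = sin \<theta>"
    by (rule sincos_total_2pi)
  then have \<theta>: "\<delta> = r * cos \<theta>" "\<gamma> = r * sin \<theta>"
    using r(1) by (simp_all add: field_simps)
  \<comment> \<open>The shear entry: the rows of diagonal times rotation are orthogonal, so the
    inner product of the two rows of the given matrix is \<open>k\<close> times the squared length
    of the lower one.\<close>
  define k where "k = (\<alpha> * \<gamma> + \<beta> * \<delta>) / r\<^sup>2"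
  \<comment> \<open>Interpolates between 1 and \<open>r\<close> without vanishing, so that division
    by it stays continuous.\<close>
  define R where "R s = exp (s * ln r)" for s
  have R: "R s \<noteq> 0" "continuous_on UNIV R" "R 0 = 1" "R 1 = r" for s
    using r(1) by (auto simp: R_def [abs_def] intro!: continuous_intros)
  show thesis
  proof
    show "continuous_on UNIV (\<lambda>s. cos (s * \<theta>) / R s + s * k * R s * sin (s * \<theta>))"
      "continuous_on UNIV (\<lambda>s. - sin (s * \<theta>) / R s + s * k * R s * cos (s * \<theta>))"
      "continuous_on UNIV (\<lambda>s. R s * sin (s * \<theta>))" "continuous_on UNIV (\<lambda>s. R s * cos (s * \<theta>))"
      using R by (auto intro!: continuous_intros)
    have "(c / R s + s * k * R s * d) * (R s * c) - (- d / R s + s * k * R s * c) * (R s * d)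
      = c\<^sup>2 + d\<^sup>2" for s c d
      using R(1) [of s] by (simp add: field_simps power2_eq_square)
    then show "\<forall>s. (cos (s * \<theta>) / R s + s * k * R s * sin (s * \<theta>)) * (R s * cos (s * \<theta>))
      - (- sin (s * \<theta>) / R s + s * k * R s * cos (s * \<theta>)) * (R s * sin (s * \<theta>)) = 1"
      by simp
    \<comment> \<open>With determinant 1, the upper row is a combination of the lower row and the
      lower row turned by a right angle.\<close>
    have "\<alpha> * r\<^sup>2 = \<delta> + (\<alpha> * \<gamma> + \<beta> * \<delta>) * \<gamma>" "\<beta> * r\<^sup>2 = - \<gamma> + (\<alpha> * \<gamma> + \<beta> * \<delta>) * \<delta>"
      using det unfolding r(2) by algebra+
    then have "\<alpha> = (\<delta> + (\<alpha> * \<gamma> + \<beta> * \<delta>) * \<gamma>) / r\<^sup>2"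
      "\<beta> = (- \<gamma> + (\<alpha> * \<gamma> + \<beta> * \<delta>) * \<delta>) / r\<^sup>2"
      using r(1) nonzero_eq_divide_eq [of "r\<^sup>2"] by auto
    then have "\<alpha> = \<delta> / r\<^sup>2 + k * \<gamma>" "\<beta> = - \<gamma> / r\<^sup>2 + k * \<delta>"
      unfolding k_def by (simp_all only: add_divide_distrib distrib_right times_divide_eq_left)
    then show "cos (1 * \<theta>) / R 1 + 1 * k * R 1 * sin (1 * \<theta>) = \<alpha>"
      "- sin (1 * \<theta>) / R 1 + 1 * k * R 1 * cos (1 * \<theta>) = \<beta>"
      using r(1) R(4) \<theta> by (simp_all add: power2_eq_square)
  qed (use R \<theta> in simp_all)
qed

text \<open>Reduces paths in \<open>G\<close> to paths of parameters: the formula for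
  \<open>Phi\<close> is continuous where the denominator is nonzero, so only the parameter function
  needs a joint openness and continuity condition.\<close>

lemma continuous_path_Phi:
  fixes P :: "real \<Rightarrow> params"
  defines "E \<equiv> {(s, z). s \<in> {0..1} \<and> z \<in> dom (sol (P s))}"
  assumes valid: "\<And>s. s \<in> {0..1} \<Longrightarrow> valid_params (P s)"
    and cont: "continuous_on UNIV (\<lambda>s. alpha (P s))" "continuous_on UNIV (\<lambda>s. beta (P s))"
      "continuous_on UNIV (\<lambda>s. gamma (P s))" "continuous_on UNIV (\<lambda>s. delta (P s))"
      "continuous_on UNIV (\<lambda>s. lambda0 (P s))" "continuous_on UNIV (\<lambda>s. lambda1 (P s))"
      "continuous_on UNIV (\<lambda>s. lambda2 (P s))" "continuous_on UNIV (\<lambda>s. lambda3 (P s))"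
      "continuous_on UNIV (\<lambda>s. sigma (P s))"
    and open_E: "openin (top_of_set ({0..1} \<times> UNIV)) E"
    and cont_sol: "continuous_on E (\<lambda>(s, z). the (sol (P s) z))"
  shows "continuous_path_in_G (\<lambda>s. Phi (P s))"
proof -
  define W where "W = {(s, w). s \<in> {0..1} \<and> w \<in> dom (Phi (P s))}"
  define Z :: "real \<times> point \<Rightarrow> base_point"
    where "Z = (\<lambda>w. (fst (snd w), fst (snd (snd w)), fst (snd (snd (snd w)))))"
  note cont' = cont [THEN continuous_on_compose2 [OF _ continuous_on_fst [OF continuous_on_id]], simplified]
  have Z: "continuous_on A Z" for A
    unfolding Z_def by (intro continuous_intros)
  have den: "continuous_on A (\<lambda>w. den (P (fst w)) (fst (snd w)))" for A :: "(real \<times> point) set"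
    unfolding den_def by (intro continuous_intros cont')
  have W_iff: "w \<in> W \<longleftrightarrow> (fst w, Z w) \<in> E \<and> den (P (fst w)) (fst (snd w)) \<noteq> 0" for w
    by (cases w rule: prod_cases5) (auto simp: W_def E_def Z_def mem_dom_Phi)
  obtain T where T: "open T" "E = ({0..1} \<times> UNIV) \<inter> T"
    using open_E by (auto simp: openin_open)
  \<comment> \<open>The total domain is the preimage of \<open>E\<close> under dropping
    \<open>u\<close>, with the closed zero set of the denominator removed.\<close>
  have "W = ({0..1} \<times> UNIV) \<inter> ((\<lambda>w. (fst w, Z w)) -` T \<inter> {w. den (P (fst w)) (fst (snd w)) \<noteq> 0})"
    using W_iff T(2) by auto
  moreover have "open ((\<lambda>w. (fst w, Z w)) -` T \<inter> {w. den (P (fst w)) (fst (snd w)) \<noteq> 0})"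
    by (intro open_Int open_vimage T(1) open_Collect_neq den continuous_intros Z)
  ultimately have "openin (top_of_set ({0..1} \<times> UNIV)) W"
    unfolding openin_open by blast
  moreover have "continuous_on W (\<lambda>(s, w). the (Phi (P s) w))"
  proof -
    have nz: "\<forall>w\<in>W. den (P (fst w)) (fst (snd w)) \<noteq> 0"
      using W_iff by blast
    have xh: "continuous_on W (\<lambda>w. x_hat (P (fst w)) (Z w))"
      and yh: "continuous_on W (\<lambda>w. y_hat (P (fst w)) (Z w))"
      unfolding x_hat_def y_hat_def Z_def prod.case by (intro continuous_intros cont')+
    have base: "continuous_on W (\<lambda>w. base_part (P (fst w)) (Z w))"
      using xh yh nz unfolding base_part_def Z_def prod.case
      by (intro continuous_intros cont' den) auto
    have mult: "continuous_on W (\<lambda>w. multiplier (P (fst w)) (Z w))"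
      using xh yh nz unfolding multiplier_def Let_def Z_def prod.case
      by (intro continuous_intros cont' den) auto
    have "continuous_on W (\<lambda>w. (\<lambda>(s, z). the (sol (P s) z)) (fst w, Z w))"
      by (rule continuous_on_compose2 [OF cont_sol])
        (use W_iff Z in \<open>auto intro!: continuous_intros\<close>)
    then have "continuous_on W (\<lambda>w. the (sol (P (fst w)) (Z w)))"
      by simp
    with base mult have "continuous_on W (\<lambda>w. (fst (base_part (P (fst w)) (Z w)),
        fst (snd (base_part (P (fst w)) (Z w))), snd (snd (base_part (P (fst w)) (Z w))),
        multiplier (P (fst w)) (Z w) * (snd (snd (snd (snd w))) + the (sol (P (fst w)) (Z w)))))"
      by (intro continuous_intros)
    then show ?thesis
    proof (rule continuous_on_eq)
      fix w assume "w \<in> W"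
      then show "(fst (base_part (P (fst w)) (Z w)),
        fst (snd (base_part (P (fst w)) (Z w))), snd (snd (base_part (P (fst w)) (Z w))),
        multiplier (P (fst w)) (Z w) * (snd (snd (snd (snd w))) + the (sol (P (fst w)) (Z w)))) =
        (case w of (s, w) \<Rightarrow> the (Phi (P s) w))"
        by (cases w rule: prod_cases5) (auto simp: W_iff E_def Z_def the_Phi)
    qed
  qed
  ultimately show ?thesis
    using valid unfolding continuous_path_in_G_def W_def G_def by blast
qed

lemma identity_component_if_sigma_pos:
  assumes p: "valid_params p" and pos: "sigma p > 0"
  shows "Phi p \<in> identity_component"
proof -
  have det: "alpha p * delta p - beta p * gamma p = 1"
    using p by (simp add: valid_params_def)
  obtain A B C D :: "real \<Rightarrow> real" where ABCD:
    "continuous_on UNIV A" "continuous_on UNIV B" "continuous_on UNIV C" "continuous_on UNIV D"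
    "\<forall>s. A s * D s - B s * C s = 1"
    "A 0 = 1" "B 0 = 0" "C 0 = 0" "D 0 = 1"
    "A 1 = alpha p" "B 1 = beta p" "C 1 = gamma p" "D 1 = delta p"
    by (rule SL2_path [OF det])
  define P where "P s = \<lparr>alpha = A s, beta = B s, gamma = C s, delta = D s,
    lambda0 = s * lambda0 p, lambda1 = s * lambda1 p, lambda2 = s * lambda2 p, lambda3 = s * lambda3 p,
    sigma = exp (s * ln (sigma p)),
    sol = if s < 1 / 2 then (\<lambda>z. Some 0) else scaled_sol (2 * s - 1) (sol p)\<rparr>" for s
  \<comment> \<open>Only the total domain must be open, so the domain of the parameter function may shrink abruptly
    to \<^term>\<open>dom (sol p)\<close> at \<open>s = 1/2\<close>, where its values still vanish.\<close>
  let ?E = "{(s, z). s \<in> {0..1} \<and> z \<in> dom (sol (P s))}"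
  let ?T1 = "{..<1/2 :: real} \<times> (UNIV :: base_point set)"
  let ?T2 = "(UNIV :: real set) \<times> dom (sol p)"
  have T: "open ?T1" "open ?T2"
    using open_dom_sol [OF p] by (auto intro: open_Times)
  have E: "?E = ({0..1} \<times> UNIV) \<inter> (?T1 \<union> ?T2)"
    by (auto simp: P_def scaled_sol_def split: if_splits)
  have "P 0 = scaling_params 1"
    using ABCD by (simp add: P_def scaling_params_def)
  then have P0: "Phi (P 0) = Some"
    by (simp add: Phi_scaling_params u_scaling_1)
  have P1: "P 1 = p"
    using ABCD pos by (simp add: P_def)
  have "continuous_path_in_G (\<lambda>s. Phi (P s))"
  proof (rule continuous_path_Phi)
    show "valid_params (P s)" for s
      using ABCD(5) p by (simp add: valid_params_def P_def is_solution_zero is_solution_scaled_sol)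
    show "openin (top_of_set ({0..1} \<times> UNIV)) ?E"
      unfolding E using T by (auto simp: openin_open)
    \<comment> \<open>One formula covers both halves of the path: on \<open>?T1\<close> the factor
      is 0, whatever the unspecified values off \<open>dom (sol p)\<close> are.\<close>
    have "continuous_on (?T1 \<union> ?T2) (\<lambda>w. max 0 (2 * fst w - 1) * the (sol p (snd w)))"
    proof (rule continuous_on_open_Un [OF T])
      show "continuous_on ?T1 (\<lambda>w. max 0 (2 * fst w - 1) * the (sol p (snd w)))"
        by (rule continuous_on_eq [OF continuous_on_const [of _ 0]]) (auto simp: max_def)
      have "Ck_on 0 (\<lambda>z. the (sol p z)) (dom (sol p))"
        using p unfolding valid_params_def is_solution_def smooth_on_def by blast
      then have "continuous_on (dom (sol p)) (\<lambda>z. the (sol p z))" by simp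
      then have "continuous_on ?T2 (\<lambda>w. the (sol p (snd w)))"
        by (rule continuous_on_compose2) (auto intro: continuous_intros)
      then show "continuous_on ?T2 (\<lambda>w. max 0 (2 * fst w - 1) * the (sol p (snd w)))"
        by (intro continuous_intros)
    qed
    then have "continuous_on ?E (\<lambda>w. max 0 (2 * fst w - 1) * the (sol p (snd w)))"
      by (rule continuous_on_subset) (use E in auto)
    then show "continuous_on ?E (\<lambda>(s, z). the (sol (P s) z))"
      by (rule continuous_on_eq) (auto simp: P_def scaled_sol_def max_def)
  qed (auto simp: P_def intro!: continuous_intros ABCD)
  with P0 P1 show ?thesis
    unfolding identity_component_def by auto
qed

text \<open>The sign is locally constant on a connected interval. Since \<open>P\<close> is an
  arbitrary choice of parameters, continuity has to come from \<open>F\<close> itself.\<close>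

lemma sgn_sigma_path:
  assumes F: "continuous_path_in_G F"
    and P: "\<And>s. s \<in> {0..1} \<Longrightarrow> valid_params (P s) \<and> F s = Phi (P s)"
  shows "sgn (sigma (P 0)) = sgn (sigma (P 1))"
proof (rule connected_local_const [where A = "{0..1::real}" and f = "\<lambda>s. sgn (sigma (P s))"])
  let ?I = "{0..1::real}"
  let ?E = "{(s, w). s \<in> ?I \<and> w \<in> dom (F s)}"
  have openE: "openin (top_of_set (?I \<times> UNIV)) ?E" and contE: "continuous_on ?E (\<lambda>(s, w). the (F s w))"
    using F unfolding continuous_path_in_G_def by auto
  then obtain T where T: "open T" "?E = (?I \<times> UNIV) \<inter> T"
    by (auto simp: openin_open)
  show "\<forall>a\<in>?I. eventually (\<lambda>s. sgn (sigma (P a)) = sgn (sigma (P s))) (at a within ?I)"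
  proof
    fix a assume a: "a \<in> ?I"
    obtain t x y where z: "(t, x, y) \<in> dom (sol (P a))" "den (P a) t \<noteq> 0"
      using dom_Phi_nonempty P [OF a] by metis
    let ?w = "\<lambda>u. (t, x, y, u)"
    let ?U = "(\<lambda>s. (s, ?w 0)) -` T \<inter> (\<lambda>s. (s, ?w 1)) -` T"
    \<comment> \<open>This is the multiplier of \<open>F s\<close> at a fixed base point, expressed
      through values of \<open>F\<close> alone; \<open>?U\<close> keeps both evaluation points in
      the domain.\<close>
    define h where "h s = snd (snd (snd (the (F s (?w 1))))) - snd (snd (snd (the (F s (?w 0)))))" for s
    have U: "open ?U"
      by (intro open_Int open_vimage T(1) continuous_intros)
    have "(a, ?w u) \<in> ?E" for u
      using a z P [OF a] mem_dom_Phi by auto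
    then have aU: "a \<in> ?U" using T(2) by auto
    have IU: "(s, ?w 0) \<in> ?E" "(s, ?w 1) \<in> ?E" if "s \<in> ?I \<inter> ?U" for s
      using that T(2) by auto
    have h: "sgn (h s) = sgn (sigma (P s))" "h s \<noteq> 0" if "s \<in> ?I \<inter> ?U" for s
    proof -
      have "(t, x, y, 0) \<in> dom (Phi (P s))"
        using IU(1) [OF that] P that by auto
      then have d: "(t, x, y) \<in> dom (sol (P s))" "den (P s) t \<noteq> 0"
        by (simp_all add: mem_dom_Phi)
      then have "h s = multiplier (P s) (t, x, y)"
        using P that by (simp add: h_def the_Phi algebra_simps)
      then show "sgn (h s) = sgn (sigma (P s))" by (simp add: sgn_multiplier d)
      moreover have "sigma (P s) \<noteq> 0" using P that by (auto simp: valid_params_def)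
      ultimately show "h s \<noteq> 0" by (metis sgn_zero_iff)
    qed
    have "continuous_on (?I \<inter> ?U) (\<lambda>s. (\<lambda>(s, w). the (F s w)) (s, ?w u))" if "u \<in> {0, 1}" for u
    proof (rule continuous_on_compose2 [OF contE])
      show "continuous_on (?I \<inter> ?U) (\<lambda>s. (s, ?w u))"
        by (intro continuous_intros)
      show "(\<lambda>s. (s, ?w u)) ` (?I \<inter> ?U) \<subseteq> ?E"
        using IU that by blast
    qed
    from this [of 0] this [of 1] have "continuous_on (?I \<inter> ?U) h"
      unfolding h_def by (auto intro!: continuous_intros)
    then have "(h \<longlongrightarrow> h a) (at a within ?I \<inter> ?U)"
      using a aU by (auto simp: continuous_on_def)
    \<comment> \<open>A positive product with \<open>h a\<close> means equal signs, and positivity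
      persists near \<open>a\<close> by continuity.\<close>
    then have "((\<lambda>s. h s * h a) \<longlongrightarrow> h a * h a) (at a within ?I \<inter> ?U)"
      by (intro tendsto_intros)
    moreover have "h a * h a > 0"
      using h(2) [of a] a aU by (simp add: zero_less_mult_iff not_less_iff_gr_or_eq) argo
    ultimately have "eventually (\<lambda>s. h s * h a > 0) (at a within ?I \<inter> ?U)"
      by (rule order_tendstoD)
    moreover have "eventually (\<lambda>s. s \<in> ?I \<inter> ?U) (at a within ?I \<inter> ?U)"
      by (simp add: eventually_at_filter)
    ultimately have "eventually (\<lambda>s. sgn (sigma (P a)) = sgn (sigma (P s))) (at a within ?I \<inter> ?U)"
    proof eventually_elim
      case (elim s)
      then have "sgn (h a) = sgn (h s)"
        by (auto simp: zero_less_mult_iff)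
      then show ?case using h elim a aU by auto
    qed
    moreover have "at a within ?I \<inter> ?U = at a within ?I"
      by (rule at_within_nhd [OF aU U]) auto
    ultimately show "eventually (\<lambda>s. sgn (sigma (P a)) = sgn (sigma (P s))) (at a within ?I)"
      by simp
  qed
qed auto

text \<open>For the forward direction, parameters are chosen along a path; at its ends they are
  compared with those of the identity and with \<open>p\<close> through the maps they
  present.\<close>

lemma identity_component_iff:
  assumes p: "valid_params p"
  shows "Phi p \<in> identity_component \<longleftrightarrow> sigma p > 0"
proof
  assume "Phi p \<in> identity_component"
  then obtain F where F: "continuous_path_in_G F" "F 0 = Some" "F 1 = Phi p"
    unfolding identity_component_def by blast
  then have "\<forall>s\<in>{0..1}. \<exists>q. valid_params q \<and> F s = Phi q"
    unfolding continuous_path_in_G_def G_def by blast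
  then obtain P where P: "\<And>s. s \<in> {0..1} \<Longrightarrow> valid_params (P s) \<and> F s = Phi (P s)"
    by metis
  have "sgn (sigma (P 0)) = sgn (sigma (P 1))"
    by (rule sgn_sigma_path [OF F(1) P])
  moreover have "sgn (sigma (P 1)) = sgn (sigma p)"
    using P [of 1] F(3) by (intro sgn_sigma_unique) auto
  moreover have "sgn (sigma (P 0)) = sgn (sigma (scaling_params 1))"
    using P [of 0] F(2) by (intro sgn_sigma_unique) (auto simp: Phi_scaling_params u_scaling_1)
  ultimately show "sigma p > 0" by (simp add: sgn_1_pos)
qed (rule identity_component_if_sigma_pos [OF p])

section \<open>The quotient group\<close>

lemma G_cases:
  assumes "\<Phi> \<in> G"
  obtains p where "valid_params p" "\<Phi> = Phi p"
  using assms unfolding G_def by blast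

lemma Phi_in_G: "valid_params p \<Longrightarrow> Phi p \<in> G"
  unfolding G_def by blast

lemma u_scaling_in_G: "c \<noteq> 0 \<Longrightarrow> u_scaling c \<in> G"
  using Phi_in_G [OF valid_scaling_params] by (simp only: Phi_scaling_params)

lemma u_scaling_in_identity_component_iff:
  "c \<noteq> 0 \<Longrightarrow> u_scaling c \<in> identity_component \<longleftrightarrow> c > 0"
  using identity_component_iff [OF valid_scaling_params] by (simp add: Phi_scaling_params)

lemma identity_component_subset_G: "identity_component \<subseteq> G"
proof
  fix \<Phi> assume "\<Phi> \<in> identity_component"
  then obtain F where F: "\<forall>s\<in>{0..1::real}. F s \<in> G" "F 1 = \<Phi>"
    unfolding identity_component_def continuous_path_in_G_def by blast
  from F(1) [THEN bspec, of 1] F(2) show "\<Phi> \<in> G" by simp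
qed

lemma modified_comp_in_G:
  "modified_comp \<Phi>1 \<Phi>2 \<Psi> \<Longrightarrow> \<Phi>1 \<in> G \<and> \<Phi>2 \<in> G \<and> \<Psi> \<in> G"
  unfolding modified_comp_def comp_extension_def by (elim conjE exE) (simp only: Phi_in_G)

text \<open>Signs of \<open>sigma\<close> multiply, so the product is positive exactly when the two
  signs agree.\<close>

lemma modified_comp_in_identity_component_iff:
  assumes "modified_comp \<Phi>1 \<Phi>2 \<Psi>"
  shows "\<Psi> \<in> identity_component \<longleftrightarrow> (\<Phi>1 \<in> identity_component \<longleftrightarrow> \<Phi>2 \<in> identity_component)"
proof -
  obtain p1 p2 q where v: "valid_params p1" "valid_params p2" "valid_params q" and
    eq: "\<Phi>1 = Phi p1" "\<Phi>2 = Phi p2" "\<Psi> = Phi q" and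
    dom_q: "\<And>t x y. den p2 t \<noteq> 0 \<Longrightarrow> (t, x, y) \<in> dom (sol q) \<longleftrightarrow>
           (t, x, y) \<in> dom (sol p2) \<and> base_part p2 (t, x, y) \<in> dom (sol p1)" and
    le: "(\<Phi>1 \<circ>\<^sub>m \<Phi>2) \<subseteq>\<^sub>m \<Psi>"
    using assms unfolding modified_comp_def comp_extension_def by blast
  have "sgn (sigma q) = sgn (sigma p1) * sgn (sigma p2)"
    using dom_q le unfolding eq by (intro sgn_sigma_comp [OF v]) auto
  moreover have "sigma p1 \<noteq> 0" "sigma p2 \<noteq> 0" "sigma q \<noteq> 0"
    using v by (auto simp: valid_params_def)
  ultimately show ?thesis
    unfolding eq v [THEN identity_component_iff] by (auto simp: sgn_if split: if_splits)
qed

section \<open>Splitting off the identity or the sign change as inner factor\<close>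

lemma modified_comp_Some_right:
  assumes "\<Psi> \<in> G"
  shows "modified_comp \<Psi> Some \<Psi>"
proof -
  obtain p where p: "valid_params p" "\<Psi> = Phi p" using G_cases [OF assms] .
  have "rescaled 1 p = p"
    by (simp add: rescaled_def)
  then show ?thesis
    using modified_comp_u_scaling [OF p(1), of 1] p(2) by (simp add: u_scaling_1)
qed

lemma modified_comp_sign_change:
  assumes "\<Psi> \<in> G"
  obtains \<Phi> where "modified_comp \<Phi> sign_change \<Psi>"
proof -
  obtain p where p: "valid_params p" "\<Psi> = Phi p" using G_cases [OF assms] .
  \<comment> \<open>The outer factor is thus \<open>Phi (rescaled (- 1) p)\<close>.\<close>
  have "rescaled (- 1) (rescaled (- 1) p) = p"
    by (simp add: rescaled_def)
  then show thesis
    using modified_comp_u_scaling [OF valid_rescaled [OF p(1), of "- 1"], of "- 1"] p(2) that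
    by (simp add: u_scaling_minus_1)
qed

lemma Some_in_identity_component: "Some \<in> identity_component"
  using u_scaling_in_identity_component_iff [of 1] by (simp add: u_scaling_1)

lemma sign_change_in_G: "sign_change \<in> G"
  using u_scaling_in_G [of "- 1"] by (simp add: u_scaling_minus_1)

lemma sign_change_discrete: "sign_change \<notin> identity_component"
  using u_scaling_in_identity_component_iff [of "- 1"] by (simp add: u_scaling_minus_1)

lemma is_involution_sign_change: "is_involution sign_change"
proof -
  have "u_scaling (- 1) \<circ>\<^sub>m u_scaling (- 1) = Some"
    by (auto simp: u_scaling_def map_comp_def)
  then have "Phi (rescaled (- 1) (scaling_params (- 1))) = Some"
    using comp_u_scaling [of "- 1" "scaling_params (- 1)"] by (simp add: Phi_scaling_params)
  then have "modified_comp sign_change sign_change Some"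
    using modified_comp_u_scaling [OF valid_scaling_params, of "- 1" "- 1"]
    by (simp add: Phi_scaling_params u_scaling_minus_1)
  then show ?thesis
    unfolding is_involution_def using sign_change_in_G sign_change_discrete Some_in_identity_component
    by metis
qed

text \<open>Both closure operations preserve positivity of \<open>sigma\<close>. This yields the
  independence of the sign change.\<close>

lemma generated_by_identity_component:
  assumes "\<Phi> \<in> generated_by identity_component"
  shows "\<Phi> \<in> identity_component"
  using assms
proof induction
  case (comp \<Phi>1 \<Phi>2 \<Psi>)
  then show ?case using modified_comp_in_identity_component_iff by blast
next
  case (inverse \<Phi> \<Psi>)
  obtain p where p: "valid_params p" "\<Phi> = Phi p"
    using G_cases identity_component_subset_G inverse.IH by blast
  obtain q where q: "valid_params q" "\<Psi> = Phi q"
    using G_cases inverse.hyps(2) by blast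
  obtain t x y where z: "(t, x, y) \<in> dom (sol p)" "den p t \<noteq> 0"
    using dom_Phi_nonempty [OF p(1)] .
  \<comment> \<open>Over a base point of \<open>Phi p\<close>, the inverse composed with it agrees
    with the identity on a whole \<open>u\<close>-fibre, so the two signs multiply to 1.\<close>
  have "sgn (sigma (scaling_params 1)) = sgn (sigma q) * sgn (sigma p)"
  proof (rule sgn_sigma_comp_at)
    from z have "(t, x, y, u) \<in> dom \<Phi>" for u
      by (simp add: p(2) mem_dom_Phi)
    then show "(Phi q \<circ>\<^sub>m Phi p) (t, x, y, u) = Phi (scaling_params 1) (t, x, y, u)" for u
      using inverse.hyps(4) p(2) q(2) by (simp add: Phi_scaling_params u_scaling_1)
  qed simp_all
  then have "sigma q > 0"
    using identity_component_iff [OF p(1)] p(2) inverse.IH by (simp add: sgn_1_pos)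
  then show ?case using identity_component_iff [OF q(1)] q(2) by simp
qed

text \<open>Splitting the sign change off a discrete symmetry leaves an outer factor that lies in
  the identity component by the sign rule.\<close>

lemma complete_list_sign_change:
  "complete_list_of_independent_discrete_symmetries {sign_change}"
  unfolding complete_list_of_independent_discrete_symmetries_def
proof (intro conjI ballI)
  show "{sign_change} \<subseteq> discrete_symmetries"
    using sign_change_in_G sign_change_discrete by (simp add: discrete_symmetries_def)
  show "discrete_symmetries \<subseteq> generated_by (identity_component \<union> {sign_change})"
  proof
    fix \<Psi> assume "\<Psi> \<in> discrete_symmetries"
    then have \<Psi>: "\<Psi> \<in> G" "\<Psi> \<notin> identity_component" by (auto simp: discrete_symmetries_def)
    obtain \<Phi> where \<Phi>: "modified_comp \<Phi> sign_change \<Psi>"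
      using modified_comp_sign_change [OF \<Psi>(1)] .
    then have "\<Phi> \<in> identity_component"
      using modified_comp_in_identity_component_iff \<Psi>(2) sign_change_discrete by blast
    then show "\<Psi> \<in> generated_by (identity_component \<union> {sign_change})"
      by (intro generated_by.comp [OF generated_by.base generated_by.base \<Phi>]) simp_all
  qed
  show "I \<notin> generated_by (identity_component \<union> ({sign_change} - {I}))" if "I \<in> {sign_change}" for I
    using that generated_by_identity_component sign_change_discrete by auto
qed

text \<open>Each step composes with an element of positive sign and so stays in its class.
  Conversely, one common representative \<open>R\<close> reaches every element of the class in a
  single step.\<close>

lemma coset_rel_iff:
  "(\<Phi>, \<Psi>) \<in> coset_rel \<longleftrightarrow>
     \<Phi> \<in> G \<and> \<Psi> \<in> G \<and> (\<Phi> \<in> identity_component \<longleftrightarrow> \<Psi> \<in> identity_component)"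
proof
  assume "(\<Phi>, \<Psi>) \<in> coset_rel"
  then have "(\<Phi>, \<Psi>) \<in> (coset_step \<union> coset_step\<inverse>)\<^sup>*" and G: "\<Phi> \<in> G" "\<Psi> \<in> G"
    by (auto simp: coset_rel_def)
  then have "\<Phi> \<in> identity_component \<longleftrightarrow> \<Psi> \<in> identity_component"
    by induction (use modified_comp_in_identity_component_iff in \<open>auto simp: coset_step_def\<close>)
  with G show "\<Phi> \<in> G \<and> \<Psi> \<in> G \<and> (\<Phi> \<in> identity_component \<longleftrightarrow> \<Psi> \<in> identity_component)"
    by simp
next
  assume *: "\<Phi> \<in> G \<and> \<Psi> \<in> G \<and> (\<Phi> \<in> identity_component \<longleftrightarrow> \<Psi> \<in> identity_component)"
  define R where "R = (if \<Phi> \<in> identity_component then Some else sign_change)"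
  have "(R, \<Theta>) \<in> coset_step"
    if \<Theta>: "\<Theta> \<in> G" "\<Theta> \<in> identity_component \<longleftrightarrow> \<Phi> \<in> identity_component" for \<Theta>
  proof (cases "\<Phi> \<in> identity_component")
    case True
    then show ?thesis
      using \<Theta> modified_comp_Some_right [OF \<Theta>(1)] Some_in_identity_component
        identity_component_subset_G by (auto simp: coset_step_def R_def)
  next
    case False
    obtain N where N: "modified_comp N sign_change \<Theta>"
      using modified_comp_sign_change [OF \<Theta>(1)] .
    then have "N \<in> identity_component"
      using modified_comp_in_identity_component_iff \<Theta>(2) False sign_change_discrete by blast
    with N False \<Theta>(1) show ?thesis
      using sign_change_in_G by (auto simp: coset_step_def R_def)
  qed
  then have "(R, \<Phi>) \<in> coset_step" "(R, \<Psi>) \<in> coset_step"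
    using * by auto
  then have "(\<Phi>, R) \<in> (coset_step \<union> coset_step\<inverse>)\<^sup>*" "(R, \<Psi>) \<in> (coset_step \<union> coset_step\<inverse>)\<^sup>*"
    by auto
  then have "(\<Phi>, \<Psi>) \<in> (coset_step \<union> coset_step\<inverse>)\<^sup>*"
    by (rule rtrancl_trans)
  then show "(\<Phi>, \<Psi>) \<in> coset_rel"
    using * by (simp add: coset_rel_def)
qed

section \<open>The two classes and their multiplication table\<close>

lemma carrier_quotient_G: "carrier quotient_G = {identity_component, discrete_symmetries}"
proof -
  have "coset_rel `` {\<Phi>} = (if \<Phi> \<in> identity_component then identity_component else discrete_symmetries)"
    if "\<Phi> \<in> G" for \<Phi>
    using that identity_component_subset_G by (auto simp: coset_rel_iff discrete_symmetries_def)
  then have "G // coset_rel =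
      (\<lambda>\<Phi>. if \<Phi> \<in> identity_component then identity_component else discrete_symmetries) ` G"
    by (auto simp: quotient_def)
  also have "\<dots> = {identity_component, discrete_symmetries}"
    using sign_change_in_G sign_change_discrete Some_in_identity_component identity_component_subset_G
    by (force simp: image_iff)
  finally show ?thesis by (simp add: quotient_G_def)
qed

text \<open>The sign rule confines products to the stated class. Every element of that class occurs:
  the identity or the sign change, whichever lies in \<open>B\<close>, is split off, and the sign
  rule puts the outer factor in \<open>A\<close>.\<close>

lemma mult_quotient_G:
  assumes "A \<in> carrier quotient_G" "B \<in> carrier quotient_G"
  shows "A \<otimes>\<^bsub>quotient_G\<^esub> B = (if A = B then identity_component else discrete_symmetries)"
proof -
  have ne: "identity_component \<noteq> discrete_symmetries"
    using Some_in_identity_component by (auto simp: discrete_symmetries_def)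
  have AB: "A = identity_component \<or> A = discrete_symmetries" "B = identity_component \<or> B = discrete_symmetries"
    using assms by (auto simp: carrier_quotient_G)
  define C where "C = (if A = B then identity_component else discrete_symmetries)"
  have "\<Psi> \<in> A \<otimes>\<^bsub>quotient_G\<^esub> B \<longleftrightarrow> \<Psi> \<in> C" for \<Psi>
  proof
    assume "\<Psi> \<in> A \<otimes>\<^bsub>quotient_G\<^esub> B"
    then obtain \<Phi>1 \<Phi>2 where "\<Phi>1 \<in> A" "\<Phi>2 \<in> B" and c: "modified_comp \<Phi>1 \<Phi>2 \<Psi>"
      by (auto simp: quotient_G_def)
    then show "\<Psi> \<in> C"
      using AB modified_comp_in_identity_component_iff [OF c] modified_comp_in_G [OF c] ne
      by (auto simp: C_def discrete_symmetries_def)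
  next
    assume \<Psi>: "\<Psi> \<in> C"
    then have G: "\<Psi> \<in> G"
      using identity_component_subset_G by (auto simp: C_def discrete_symmetries_def split: if_splits)
    have "\<exists>\<Phi>1\<in>A. \<exists>\<Phi>2\<in>B. modified_comp \<Phi>1 \<Phi>2 \<Psi>"
    proof (cases "B = identity_component")
      case True
      then have "\<Psi> \<in> A" using \<Psi> AB by (auto simp: C_def split: if_splits)
      then show ?thesis
        using True modified_comp_Some_right [OF G] Some_in_identity_component by blast
    next
      case False
      then have B: "B = discrete_symmetries" using AB by blast
      obtain N where N: "modified_comp N sign_change \<Psi>"
        using modified_comp_sign_change [OF G] .
      then have "N \<in> A"
        using AB \<Psi> modified_comp_in_identity_component_iff [OF N] modified_comp_in_G [OF N]
          sign_change_discrete ne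
        by (auto simp: B C_def discrete_symmetries_def split: if_splits)
      moreover have "sign_change \<in> B"
        using sign_change_in_G sign_change_discrete by (simp add: B discrete_symmetries_def)
      ultimately show ?thesis using N by blast
    qed
    then show "\<Psi> \<in> A \<otimes>\<^bsub>quotient_G\<^esub> B" by (simp add: quotient_G_def)
  qed
  then show ?thesis unfolding C_def by blast
qed

lemma one_quotient_G: "\<one>\<^bsub>quotient_G\<^esub> = identity_component"
  by (simp add: quotient_G_def)

lemma group_quotient_G: "group quotient_G"
proof (rule groupI)
  let ?C = "carrier quotient_G"
  have C: "?C = {identity_component, discrete_symmetries}" by (rule carrier_quotient_G)
  show closed: "A \<otimes>\<^bsub>quotient_G\<^esub> B \<in> ?C" if "A \<in> ?C" "B \<in> ?C" for A B
    using that by (simp add: mult_quotient_G) (simp add: C)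
  show one: "\<one>\<^bsub>quotient_G\<^esub> \<in> ?C"
    by (simp add: one_quotient_G C)
  show "A \<otimes>\<^bsub>quotient_G\<^esub> B \<otimes>\<^bsub>quotient_G\<^esub> D = A \<otimes>\<^bsub>quotient_G\<^esub> (B \<otimes>\<^bsub>quotient_G\<^esub> D)"
    if "A \<in> ?C" "B \<in> ?C" "D \<in> ?C" for A B D
    using that closed [OF that(1,2)] closed [OF that(2,3)]
    by (simp only: mult_quotient_G) (auto simp: C)
  show "\<one>\<^bsub>quotient_G\<^esub> \<otimes>\<^bsub>quotient_G\<^esub> A = A" if "A \<in> ?C" for A
    using that mult_quotient_G [OF one that] by (auto simp: one_quotient_G C)
  \<comment> \<open>Each class is its own inverse.\<close>
  show "\<exists>B\<in>?C. B \<otimes>\<^bsub>quotient_G\<^esub> A = \<one>\<^bsub>quotient_G\<^esub>" if "A \<in> ?C" for A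
    using that mult_quotient_G [OF that that] by (auto simp: one_quotient_G)
qed

lemma quotient_G_iso: "quotient_G \<cong> integer_mod_group 2"
proof -
  let ?h = "\<lambda>A. if A = identity_component then 0 else 1 :: int"
  have ne: "identity_component \<noteq> discrete_symmetries"
    using Some_in_identity_component by (auto simp: discrete_symmetries_def)
  have Z: "carrier (integer_mod_group 2) = {0, 1}"
    by (auto simp: carrier_integer_mod_group)
  have "?h \<in> hom quotient_G (integer_mod_group 2)"
    using ne by (auto simp: hom_def mult_quotient_G carrier_quotient_G Z)
  moreover have "bij_betw ?h (carrier quotient_G) (carrier (integer_mod_group 2))"
    using ne by (auto simp: bij_betw_def inj_on_def carrier_quotient_G Z)
  ultimately show ?thesis by (intro is_isoI isoI)
qed

theorem corollary3:
  shows "complete_list_of_independent_discrete_symmetries {sign_change} \<and>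
         is_involution sign_change \<and>
         group quotient_G \<and>
         quotient_G \<cong> integer_mod_group 2"
  using complete_list_sign_change is_involution_sign_change group_quotient_G quotient_G_iso by blast

end
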